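(* Let $n,K\ge1$ and let $\mathbf q\ge\mathbf 0$, $\mathbf s\ge\mathbf 0$ be such that $p_i=2q_i+s_i\ge1$ for all $i$. Then $f^{(\mathbf q;\mathbf s)}_{n,K}=c^{(\mathbf q;\mathbf s)}_{n,K}$.
   Context: Notation: $\mathbf q=(q_1,\dots,q_n)$ and $\mathbf s=(s_{i,k})_{1\le i<k\le n}$ are non-negative integers, $s_{k,i}=s_{i,k}$, $s_i=\sum_{k\ne i}s_{i,k}$, $p_i=2q_i+s_i$. Paired functions: let $[p_1,\dots,p_n]$ be the disjoint union of the sets $\{1^{(i)},\dots,p_i^{(i)}\}$, $i=1,\dots,n$. A pairing is a partition into 2-element blocks, identified with the corresponding fixed-point-free involution. $\mathcal P_n^{(\mathbf q;\mathbf s)}$ is the set of pairings $\mu$ of $[p_1,\dots,p_n]$ with exactly $q_i$ pairs $\{x^{(i)},y^{(i)}\}$ for each $i$ and exactly $s_{i,k}$ pairs $\{x^{(i)},y^{(k)}\}$ for each $i<k$ (defined when all $p_i$ are positive). Let $\gamma=(1^{(1)},\dots,p_1^{(1)})\cdots(1^{(n)},\dots,p_n^{(n)})$. A paired function is a pair $(\mu,\pi)$ with $\mu\in\mathcal P_n^{(\mathbf q;\mathbf s)}$ and $\pi:[p_1,\dots,p_n]\to\{1,\dots,K\}$ satisfying $\pi(\mu(v))=\pi(\gamma(v))$ for all $v$; $f^{(\mathbf q;\mathbf s)}_{n,K}$ is the number of paired functions. Paired arrays: given also $\mathbf R=(R_1,\dots,R_n)$ with $1\le R_i\le K$, a paired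 array is an $n\times K$ grid of cells, each cell $(i,j)$ containing a possibly empty left-to-right ordered list of unlabelled vertices, row $i$ containing $p_i$ vertices in total; the vertices are partitioned into pairs (partners) with exactly $q_i$ pairs inside row $i$ and exactly $s_{i,k}$ pairs between rows $i$ and $k$ ($i<k$); exactly $R_i$ cells of row $i$ are marked. Two paired arrays are equal if they have the same numbers of vertices in each cell, the same marked cells, and the same pairing of vertex positions. Mixed pairs/vertices: those whose pair has its two vertices in different rows. Balance condition: for every cell $(i,j)$, the number of mixed vertices in $(i,j)$ equals the number of mixed pairs $\{u,v\}$ with $u$ in row $i$ and $v$ in column $j$. Forest condition: for each row $i$ let $\mathcal R_i$ be its set of marked columns, $\mathcal F_i$ its set of columns $j$ with cell $(i,j)$ nonempty, and $\psi_i:\mathcal F_i\setminus\mathcal R_i\to\{1,\dots,K\}$ send $j$ to the column of the partner of the rightmost vertex of cell $(i,j)$; the condition holds if for every $i$ and every $j\in\mathcal F_i\setminus\mathcal R_i$ there is $t\ge1$ with $\psi_i^t(j)$ defined and in $\mathcal R_i$. A paired array is proper if it satisfies both conditions. A canonical array is a proper paired array with $\mathbf R=(1,\dots,1)$; $c^{(\mathbf q;\mathbf s)}_{n,K}$ is the number of canonical arrays with parameters $n,K,\mathbf q,\mathbf s$. *)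

theory Defs
  imports "HOL-Library.FuncSet" "HOL-Library.Disjoint_Sets"
begin

text \<open>
  Rows are indexed by \<open>{1..n}\<close>, columns and function values by \<open>{1..K}\<close>. The parameters
  \<open>q\<close> and \<open>s\<close> only matter on these indices, and the diagonal values \<open>s i i\<close> are never used.
\<close>

definition row_size :: "nat \<Rightarrow> (nat \<Rightarrow> nat) \<Rightarrow> (nat \<Rightarrow> nat \<Rightarrow> nat) \<Rightarrow> nat \<Rightarrow> nat" where
  "row_size n q s i = 2 * q i + (\<Sum>k \<in> {1..n} - {i}. s i k)"

definition is_pairing :: "'a set \<Rightarrow> 'a set set \<Rightarrow> bool" where
  "is_pairing V M \<longleftrightarrow> partition_on V M \<and> (\<forall>B\<in>M. card B = 2)"

text \<open>The fixed-point-free involution corresponding to a pairing.\<close>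

definition partner :: "'a set set \<Rightarrow> 'a \<Rightarrow> 'a" where
  "partner M v = (THE w. {v, w} \<in> M)"

text \<open>
  In both kinds of objects below a vertex is a tuple whose first component is its row, so
  that \<open>fst ` B\<close> is the set of rows met by the pair \<open>B\<close>.
\<close>

definition has_pair_counts ::
    "nat \<Rightarrow> (nat \<Rightarrow> nat) \<Rightarrow> (nat \<Rightarrow> nat \<Rightarrow> nat) \<Rightarrow> (nat \<times> 'a) set set \<Rightarrow> bool" where
  "has_pair_counts n q s M \<longleftrightarrow>
     (\<forall>i\<in>{1..n}. card {B \<in> M. fst ` B = {i}} = q i) \<and>
     (\<forall>i\<in>{1..n}. \<forall>k\<in>{1..n}. i < k \<longrightarrow> card {B \<in> M. fst ` B = {i, k}} = s i k)"


subsection \<open>Paired functions\<close>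

text \<open>The element \<open>x\<^sup>(\<^sup>i\<^sup>)\<close> of \<open>[p\<^sub>1, \<dots>, p\<^sub>n]\<close> is represented by \<open>(i, x)\<close>.\<close>

definition labels :: "nat \<Rightarrow> (nat \<Rightarrow> nat) \<Rightarrow> (nat \<times> nat) set" where
  "labels n p = (SIGMA i : {1..n}. {1..p i})"

definition pairings ::
    "nat \<Rightarrow> (nat \<Rightarrow> nat) \<Rightarrow> (nat \<Rightarrow> nat \<Rightarrow> nat) \<Rightarrow> (nat \<times> nat) set set set" where
  "pairings n q s =
     {M. is_pairing (labels n (row_size n q s)) M \<and> has_pair_counts n q s M}"

text \<open>
  The permutation \<open>\<gamma>\<close> with cycles \<open>(1\<^sup>(\<^sup>i\<^sup>), \<dots>, p\<^sub>i\<^sup>(\<^sup>i\<^sup>))\<close>; only its values on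
  \<open>labels n p\<close> are meaningful.
\<close>

definition cyc :: "(nat \<Rightarrow> nat) \<Rightarrow> nat \<times> nat \<Rightarrow> nat \<times> nat" where
  "cyc p = (\<lambda>(i, x). (i, if x = p i then 1 else x + 1))"

definition paired_functions ::
    "nat \<Rightarrow> nat \<Rightarrow> (nat \<Rightarrow> nat) \<Rightarrow> (nat \<Rightarrow> nat \<Rightarrow> nat) \<Rightarrow>
     ((nat \<times> nat) set set \<times> (nat \<times> nat \<Rightarrow> nat)) set" where
  "paired_functions n K q s =
     {(M, f). M \<in> pairings n q s \<and>
              f \<in> labels n (row_size n q s) \<rightarrow>\<^sub>E {1..K} \<and>
              (\<forall>v \<in> labels n (row_size n q s).
                 f (partner M v) = f (cyc (row_size n q s) v))}"

definition num_paired_functions ::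
    "nat \<Rightarrow> nat \<Rightarrow> (nat \<Rightarrow> nat) \<Rightarrow> (nat \<Rightarrow> nat \<Rightarrow> nat) \<Rightarrow> nat" where
  "num_paired_functions n K q s = card (paired_functions n K q s)"


subsection \<open>Paired arrays\<close>

text \<open>
  The vertices of an array are unlabelled, so a vertex is identified with its position
  \<open>(i, j, l)\<close>: the \<open>l\<close>-th vertex from the left (\<open>l \<ge> 1\<close>) in cell \<open>(i, j)\<close>. An array is then
  determined by its cell sizes, its marked cells and its pairing of positions.
\<close>

type_synonym position = "nat \<times> nat \<times> nat"

abbreviation row :: "position \<Rightarrow> nat" where "row v \<equiv> fst v"
abbreviation col :: "position \<Rightarrow> nat" where "col v \<equiv> fst (snd v)"

record array =
  cell_size :: "nat \<times> nat \<Rightarrow> nat"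
  marked :: "(nat \<times> nat) set"
  pairs :: "position set set"

definition positions :: "nat \<Rightarrow> nat \<Rightarrow> array \<Rightarrow> position set" where
  "positions n K A =
     {(i, j, l). i \<in> {1..n} \<and> j \<in> {1..K} \<and> l \<in> {1..cell_size A (i, j)}}"

text \<open>
  \<open>cell_size\<close> is required to be extensional so that equality of records is equality of
  arrays on the \<open>n \<times> K\<close> grid.
\<close>

definition is_paired_array ::
    "nat \<Rightarrow> nat \<Rightarrow> (nat \<Rightarrow> nat) \<Rightarrow> (nat \<Rightarrow> nat \<Rightarrow> nat) \<Rightarrow> (nat \<Rightarrow> nat) \<Rightarrow> array \<Rightarrow> bool" where
  "is_paired_array n K q s R A \<longleftrightarrow>
     cell_size A \<in> extensional ({1..n} \<times> {1..K}) \<and>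
     (\<forall>i\<in>{1..n}. (\<Sum>j\<in>{1..K}. cell_size A (i, j)) = row_size n q s i) \<and>
     is_pairing (positions n K A) (pairs A) \<and>
     has_pair_counts n q s (pairs A) \<and>
     marked A \<subseteq> {1..n} \<times> {1..K} \<and>
     (\<forall>i\<in>{1..n}. card {j. (i, j) \<in> marked A} = R i)"

definition mixed_pairs :: "array \<Rightarrow> position set set" where
  "mixed_pairs A = {B \<in> pairs A. \<exists>u\<in>B. \<exists>v\<in>B. row u \<noteq> row v}"

definition mixed_vertices :: "array \<Rightarrow> position set" where
  "mixed_vertices A = \<Union> (mixed_pairs A)"

definition balanced :: "nat \<Rightarrow> nat \<Rightarrow> array \<Rightarrow> bool" where
  "balanced n K A \<longleftrightarrow>
     (\<forall>i\<in>{1..n}. \<forall>j\<in>{1..K}.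
        card {v \<in> mixed_vertices A. row v = i \<and> col v = j} =
        card {B \<in> mixed_pairs A. \<exists>u v. B = {u, v} \<and> row u = i \<and> col v = j})"

definition marked_cols :: "array \<Rightarrow> nat \<Rightarrow> nat set" where
  "marked_cols A i = {j. (i, j) \<in> marked A}"

definition nonempty_cols :: "nat \<Rightarrow> array \<Rightarrow> nat \<Rightarrow> nat set" where
  "nonempty_cols K A i = {j \<in> {1..K}. cell_size A (i, j) > 0}"

text \<open>
  The function \<open>\<psi>\<^sub>i\<close>, as a partial map with domain \<open>nonempty_cols K A i - marked_cols A i\<close>.
  The rightmost vertex of cell \<open>(i, j)\<close> has position \<open>(i, j, cell_size A (i, j))\<close>.
\<close>

definition psi :: "nat \<Rightarrow> array \<Rightarrow> nat \<Rightarrow> nat \<rightharpoonup> nat" where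
  "psi K A i j =
     (if j \<in> nonempty_cols K A i - marked_cols A i
      then Some (col (partner (pairs A) (i, j, cell_size A (i, j)))) else None)"

text \<open>\<open>((\<circ>\<^sub>m) f ^^ t) Some\<close> is the \<open>t\<close>-fold iterate of the partial map \<open>f\<close>.\<close>

definition forest_cond :: "nat \<Rightarrow> nat \<Rightarrow> array \<Rightarrow> bool" where
  "forest_cond n K A \<longleftrightarrow>
     (\<forall>i\<in>{1..n}. \<forall>j \<in> nonempty_cols K A i - marked_cols A i.
        \<exists>t\<ge>1. \<exists>r\<in>marked_cols A i. ((\<circ>\<^sub>m) (psi K A i) ^^ t) Some j = Some r)"

definition proper :: "nat \<Rightarrow> nat \<Rightarrow> array \<Rightarrow> bool" where
  "proper n K A \<longleftrightarrow> balanced n K A \<and> forest_cond n K A"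

definition canonical_arrays ::
    "nat \<Rightarrow> nat \<Rightarrow> (nat \<Rightarrow> nat) \<Rightarrow> (nat \<Rightarrow> nat \<Rightarrow> nat) \<Rightarrow> array set" where
  "canonical_arrays n K q s =
     {A. is_paired_array n K q s (\<lambda>i. 1) A \<and> proper n K A}"

definition num_canonical_arrays ::
    "nat \<Rightarrow> nat \<Rightarrow> (nat \<Rightarrow> nat) \<Rightarrow> (nat \<Rightarrow> nat \<Rightarrow> nat) \<Rightarrow> nat" where
  "num_canonical_arrays n K q s = card (canonical_arrays n K q s)"

end

theory Submission
  imports Defs
begin

text \<open>
  A paired function \<open>(\<mu>, \<pi>)\<close> is turned into an array by putting the vertex \<open>x\<^sup>(\<^sup>i\<^sup>)\<close> into the cell
  \<open>(i, \<pi>(x\<^sup>(\<^sup>i\<^sup>)))\<close>, ordering each cell by increasing \<open>x\<close> and marking in row \<open>i\<close> the cell of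
  \<open>1\<^sup>(\<^sup>i\<^sup>)\<close>. Read every vertex of row \<open>i\<close> as an edge from its column to the column of its
  partner. The condition on \<open>\<pi>\<close> then says that \<open>\<pi>(1\<^sup>(\<^sup>i\<^sup>)), \<dots>, \<pi>(p\<^sub>i\<^sup>(\<^sup>i\<^sup>))\<close> is an Eulerian tour of
  this digraph starting in the marked column, in which the out-edges of every column are used
  from left to right. As in the BEST theorem, an out-edge ordering comes from such a tour
  exactly if the digraph is balanced and the last out-edges of the other columns form a forest
  leading to the marked one, and the tour is recovered as the greedy walk.
\<close>

subsection \<open>Counting visits along a walk\<close>

definition visits :: "(nat \<Rightarrow> 'a) \<Rightarrow> nat \<Rightarrow> 'a \<Rightarrow> nat" where
  "visits f x j = card {y \<in> {1..x}. f y = j}"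

lemma visits_0 [simp]: "visits f 0 j = 0"
  by (simp add: visits_def)

lemma visits_Suc [simp]: "visits f (Suc x) j = visits f x j + (if f (Suc x) = j then 1 else 0)"
proof -
  have "{y \<in> {1..Suc x}. f y = j} = {y \<in> {1..x}. f y = j} \<union> (if f (Suc x) = j then {Suc x} else {})"
    by (auto simp: le_Suc_eq)
  then show ?thesis by (simp add: visits_def)
qed

lemma visits_cong: "(\<And>y. y \<in> {1..x} \<Longrightarrow> f y = g y) \<Longrightarrow> visits f x j = visits g x j"
  unfolding visits_def by (metis (mono_tags, lifting) Collect_cong)

lemma visits_mono: "x \<le> y \<Longrightarrow> visits f x j \<le> visits f y j"
  by (auto simp: visits_def intro!: card_mono)

lemma visits_pos: "1 \<le> x \<Longrightarrow> 1 \<le> visits f x (f x)"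
  by (cases x) auto

lemma visits_less: "x < y \<Longrightarrow> visits f x (f y) < visits f y (f y)"
  using visits_mono[of x "y - 1" f "f y"] by (cases y) auto

lemma inj_on_visits: "inj_on (\<lambda>x. (f x, visits f x (f x))) A"
  by (rule inj_onI) (metis linorder_neqE_nat order_less_irrefl prod.inject visits_less)

text \<open>The count of visits to \<open>j\<close> grows by at most one per step, and only at a
  visit to \<open>j\<close>, so no value up to the final count is skipped.\<close>

lemma ex_visit:
  assumes "l \<in> {1..visits f N j}"
  shows "\<exists>x\<in>{1..N}. f x = j \<and> visits f x j = l"
  using assms
proof (induction N)
  case (Suc N)
  show ?case
  proof (cases "l \<le> visits f N j")
    case True
    then show ?thesis using Suc by force
  next
    case False
    then show ?thesis using Suc.prems
      by (intro bexI[of _ "Suc N"]) (auto split: if_splits)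
  qed
qed simp

text \<open>Matches times with pairs of a value and a visit number. Such pairs serve below both as
  out-edges (the \<open>l\<close>-th visit uses the \<open>l\<close>-th out-edge) and as positions
  within the cells of a row.\<close>

lemma bij_betw_visits:
  assumes "\<And>x. x \<in> {1..N} \<Longrightarrow> f x \<in> J"
  shows "bij_betw (\<lambda>x. (f x, visits f x (f x))) {1..N} (SIGMA j:J. {1..visits f N j})"
proof (rule bij_betw_imageI[OF inj_on_visits])
  show "(\<lambda>x. (f x, visits f x (f x))) ` {1..N} = (SIGMA j:J. {1..visits f N j})"
  proof (intro equalityI subsetI)
    fix e assume "e \<in> (\<lambda>x. (f x, visits f x (f x))) ` {1..N}"
    then show "e \<in> (SIGMA j:J. {1..visits f N j})"
      using assms visits_pos visits_mono by fastforce
  next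
    fix e assume "e \<in> (SIGMA j:J. {1..visits f N j})"
    then obtain x where "x \<in> {1..N}" "f x = fst e" "visits f x (fst e) = snd e"
      using ex_visit[of "snd e" f N "fst e"] by auto
    then show "e \<in> (\<lambda>x. (f x, visits f x (f x))) ` {1..N}"
      by (intro image_eqI[of _ _ x]) auto
  qed
qed

lemma sum_visits:
  assumes "finite J" "\<And>x. x \<in> {1..N} \<Longrightarrow> f x \<in> J"
  shows "(\<Sum>j\<in>J. visits f N j) = N"
  using bij_betw_same_card[OF bij_betw_visits[OF assms(2)]] assms(1) by simp

text \<open>Every visit up to time \<open>Suc x\<close> is either the start or an arrival from the
  preceding time.\<close>

lemma visits_shift: "card {y \<in> {1..x}. f (Suc y) = j} + (if f 1 = j then 1 else 0) = visits f (Suc x) j"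
proof (induction x)
  case (Suc x)
  have "{y \<in> {1..Suc x}. f (Suc y) = j}
      = {y \<in> {1..x}. f (Suc y) = j} \<union> (if f (Suc (Suc x)) = j then {Suc x} else {})"
    by (auto simp: le_Suc_eq)
  then have "card {y \<in> {1..Suc x}. f (Suc y) = j}
      = card {y \<in> {1..x}. f (Suc y) = j} + (if f (Suc (Suc x)) = j then 1 else 0)" by simp
  then show ?case using Suc by (simp only: visits_Suc[of f "Suc x"]) 
qed simp


subsection \<open>Eulerian tours of a digraph with ordered out-edges\<close>

text \<open>
  The digraph has vertex set \<open>J\<close>; the \<open>l\<close>-th out-edge of \<open>j\<close> is \<open>(j, l)\<close> with
  \<open>1 \<le> l \<le> c j\<close>, and \<open>h (j, l)\<close> is its head. A greedy walk leaves \<open>j\<close> along the first unused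
  out-edge.
\<close>

definition greedy_walk :: "('a \<times> nat \<Rightarrow> 'a) \<Rightarrow> 'a \<Rightarrow> (nat \<Rightarrow> 'a) \<Rightarrow> bool" where
  "greedy_walk h r f \<longleftrightarrow> f 1 = r \<and> (\<forall>x\<ge>1. f (Suc x) = h (f x, visits f x (f x)))"

lemma greedy_walk_exists: "\<exists>f. greedy_walk h r f"
proof -
  \<comment> \<open>The state holds the current vertex and all visit counts, the current visit
    included, hence the initial 1 at \<open>r\<close>. Times start at 1, so time \<open>x\<close>
    reads state \<open>x - 1\<close>.\<close>
  define st where "st = rec_nat (r, (\<lambda>_. 0)(r := 1 :: nat))
    (\<lambda>_ (j, cnt). let k = h (j, cnt j) in (k, cnt(k := cnt k + 1)))"
  define f where "f x = fst (st (x - 1))" for x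
  have st: "snd (st x) = visits f (Suc x)" for x
    by (induction x) (auto simp: st_def f_def fun_eq_iff Let_def split: prod.splits)
  have "f (Suc x) = h (f x, visits f x (f x))" if "x \<ge> 1" for x
  proof -
    obtain z where z: "x = Suc z" using \<open>x \<ge> 1\<close> by (cases x) auto
    show ?thesis using st[of z] unfolding z
      by (auto simp: f_def st_def Let_def split: prod.splits)
  qed
  moreover have "f 1 = r" by (simp add: f_def st_def)
  ultimately show ?thesis unfolding greedy_walk_def by blast
qed

text \<open>The assumption \<open>forest\<close> casts the forest condition as an induction rule:
  properties spread from \<open>r\<close> backwards along last out-edges to every vertex with
  out-edges. Iterates of a partial map are thereby avoided in the walk argument.\<close>

locale eulerian =
  fixes J :: "'a set" and c :: "'a \<Rightarrow> nat" and h :: "'a \<times> nat \<Rightarrow> 'a" and r :: 'a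
  assumes finJ: "finite J"
    and head_J: "\<And>e. e \<in> (SIGMA j:J. {1..c j}) \<Longrightarrow> h e \<in> J"
    and in_degree: "\<And>j. j \<in> J \<Longrightarrow> card {e \<in> (SIGMA j:J. {1..c j}). h e = j} = c j"
    and r_J: "r \<in> J"
    and nonempty: "\<exists>j\<in>J. c j > 0"
    and forest: "\<And>S j. r \<in> S \<Longrightarrow>
      (\<And>j. j \<in> J \<Longrightarrow> c j > 0 \<Longrightarrow> h (j, c j) \<in> S \<Longrightarrow> j \<in> S) \<Longrightarrow> j \<in> J \<Longrightarrow> c j > 0 \<Longrightarrow> j \<in> S"
begin

abbreviation edges :: "('a \<times> nat) set" where "edges \<equiv> (SIGMA j:J. {1..c j})"

lemma fin_edges: "finite edges" using finJ by simp

text \<open>If \<open>r\<close> had no out-edge, it would have no in-edge either. Then nothing leads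
  back from \<open>{r}\<close>, and \<open>forest\<close> would force every vertex with out-edges to
  be \<open>r\<close>.\<close>

lemma r_pos: "c r > 0"
proof (rule ccontr)
  assume "\<not> c r > 0"
  then have none: "{e \<in> edges. h e = r} = {}" using in_degree[OF r_J] fin_edges by simp
  obtain j where j: "j \<in> J" "c j > 0" using nonempty by blast
  have "j \<in> {r}"
  proof (rule forest[OF _ _ j])
    fix k assume k: "k \<in> J" "c k > 0" "h (k, c k) \<in> {r}"
    then have "(k, c k) \<in> {e \<in> edges. h e = r}" by simp
    then show "k \<in> {r}" using none by blast
  qed simp
  then show False using j \<open>\<not> c r > 0\<close> by simp
qed

context
  fixes f assumes gw: "greedy_walk h r f"
begin

abbreviation edge :: "nat \<Rightarrow> 'a \<times> nat" where "edge x \<equiv> (f x, visits f x (f x))"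

lemma f_1: "f 1 = r"
  using gw unfolding greedy_walk_def by blast

lemma f_Suc: "x \<ge> 1 \<Longrightarrow> f (Suc x) = h (edge x)"
  using gw unfolding greedy_walk_def by blast

text \<open>Different times use different edges, so arrivals can be counted by edges and compared
  with the in-degree.\<close>

lemma arrivals:
  "card (edge ` {y \<in> {1..x}. f (Suc y) = j}) + (if r = j then 1 else 0) = visits f (Suc x) j"
  using visits_shift[of x f j] f_1 by (simp add: card_image[OF inj_on_visits])

lemma arrivals_subset:
  assumes "\<And>y. y \<in> {1..x} \<Longrightarrow> edge y \<in> edges"
  shows "edge ` {y \<in> {1..x}. f (Suc y) = j} \<subseteq> {e \<in> edges. h e = j}"
  using assms f_Suc by auto

text \<open>
  A greedy walk can only get stuck at \<open>r\<close>; then all edges into \<open>r\<close> have been used, and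
  along the last-exit forest every other vertex has been exhausted as well.
\<close>

lemma stuck_imp_full:
  assumes used: "\<And>y. y \<in> {1..x} \<Longrightarrow> edge y \<in> edges"
    and ret: "f (Suc x) = r" and stuck: "visits f x r = c r"
    and j: "j \<in> J"
  shows "c j \<le> visits f x j"
proof (cases "c j > 0")
  case True
  let ?S = "{j \<in> J. c j \<le> visits f x j}"
  have "j \<in> ?S"
  proof (rule forest[OF _ _ j True])
    show "r \<in> ?S" using r_J stuck by simp
  next
    fix k assume k: "k \<in> J" "c k > 0" and kS: "h (k, c k) \<in> ?S"
    let ?m = "h (k, c k)"
    \<comment> \<open>The walk starts and ends at \<open>r\<close>, so the corrections for the start
      and for the final arrival cancel, whether or not \<open>?m\<close> is
      \<open>r\<close>.\<close>
    have "card (edge ` {y \<in> {1..x}. f (Suc y) = ?m}) = visits f x ?m"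
      using arrivals[of x ?m] ret by (auto split: if_splits)
    then have "card {e \<in> edges. h e = ?m} \<le> card (edge ` {y \<in> {1..x}. f (Suc y) = ?m})"
      using in_degree[of ?m] kS by auto
    then have "edge ` {y \<in> {1..x}. f (Suc y) = ?m} = {e \<in> edges. h e = ?m}"
      using arrivals_subset[OF used] fin_edges by (intro card_seteq) auto
    moreover have "(k, c k) \<in> {e \<in> edges. h e = ?m}" using k by auto
    \<comment> \<open>All in-edges of \<open>?m\<close> have been used, among them the last out-edge
      of \<open>k\<close>. By greediness it is used only at visit number \<open>c k\<close>, so
      \<open>k\<close> is exhausted.\<close>
    ultimately have "(k, c k) \<in> edge ` {y \<in> {1..x}. f (Suc y) = ?m}" by blast
    then obtain y where "y \<in> {1..x}" "edge y = (k, c k)" by (elim imageE) auto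
    then show "k \<in> ?S" using k visits_mono[of y x f k] by auto
  qed
  then show ?thesis by simp
qed simp

lemma edge_in_edges: "x \<in> {1..(\<Sum>j\<in>J. c j)} \<Longrightarrow> edge x \<in> edges"
proof (induction x rule: less_induct)
  case (less x)
  show ?case
  proof (cases "x = 1")
    case True
    then show ?thesis using r_J r_pos f_1 by simp
  next
    case False
    then obtain z where z: "x = Suc z" "z \<ge> 1" using less.prems by (cases x) auto
    have used: "edge y \<in> edges" if "y \<in> {1..z}" for y
      using less.IH[of y] less.prems that z by auto
    have fJ: "f x \<in> J" using used[of z] head_J[of "edge z"] f_Suc[of z] z by auto
    have le: "visits f x j \<le> c j + (if r = j then 1 else 0)" if "j \<in> J" for j
    proof -
      have "card (edge ` {y \<in> {1..z}. f (Suc y) = j}) \<le> card {e \<in> edges. h e = j}"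
        using arrivals_subset[OF used] fin_edges by (intro card_mono) auto
      then show ?thesis using arrivals[of z j] in_degree[OF that] unfolding z(1) by linarith
    qed
    have "visits f x (f x) \<le> c (f x)"
    proof (rule ccontr)
      assume neg: "\<not> ?thesis"
      then have ret: "f x = r" using le[OF fJ] by (auto split: if_splits)
      then have "visits f x r = c r + 1" using le[OF fJ] neg by auto
      then have "visits f z r = c r" using z ret by simp
      \<comment> \<open>If the walk were stuck at \<open>r\<close>, its first \<open>z\<close> steps
        would have exhausted all vertices, leaving no room for a time \<open>x = Suc z\<close>
        within the number of edges.\<close>
      then have "(\<Sum>j\<in>J. c j) \<le> (\<Sum>j\<in>J. visits f z j)"
        using stuck_imp_full[of z] used ret z by (intro sum_mono) auto
      also have "\<dots> = z" using used by (intro sum_visits finJ) auto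
      finally show False using less.prems z by simp
    qed
    then show ?thesis using fJ visits_pos[of x f] less.prems by auto
  qed
qed

lemma f_in_J: "x \<in> {1..(\<Sum>j\<in>J. c j)} \<Longrightarrow> f x \<in> J"
  using edge_in_edges by auto

text \<open>Distinct times use distinct edges, and there are as many times as edges.\<close>

lemma edge_image: "edge ` {1..(\<Sum>j\<in>J. c j)} = edges"
proof (rule card_seteq[OF fin_edges])
  show "edge ` {1..(\<Sum>j\<in>J. c j)} \<subseteq> edges" using edge_in_edges by blast
  show "card edges \<le> card (edge ` {1..(\<Sum>j\<in>J. c j)})"
    using finJ by (simp add: card_image[OF inj_on_visits])
qed

lemma visits_total:
  assumes "j \<in> J"
  shows "visits f (\<Sum>j\<in>J. c j) j = c j"
proof -
  let ?N = "\<Sum>j\<in>J. c j"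
  have "(SIGMA j:J. {1..visits f ?N j}) = edges"
    using bij_betw_imp_surj_on[OF bij_betw_visits[OF f_in_J]] edge_image by simp
  then have "(SIGMA j:J. {1..visits f ?N j}) `` {j} = edges `` {j}" by (rule arg_cong)
  moreover have "(SIGMA j:J. {1..g j}) `` {j} = {1..g j}" for g :: "'a \<Rightarrow> nat"
    using assms by auto
  ultimately have "{1..visits f ?N j} = {1..c j}" by metis
  then have "card {1..visits f ?N j} = card {1..c j}" by (rule arg_cong)
  then show ?thesis by simp
qed

text \<open>The final vertex has already been left \<open>c\<close> times, so this is its visit
  number \<open>c + 1\<close>. In-edges account for at most \<open>c\<close> of these visits; the
  remaining one must be the start.\<close>

lemma walk_closes: "f (Suc (\<Sum>j\<in>J. c j)) = r"
proof -
  let ?N = "\<Sum>j\<in>J. c j" let ?j = "f (Suc ?N)"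
  have N: "?N \<ge> 1" using member_le_sum[OF r_J, of c] r_pos finJ by simp
  then have "edge ?N \<in> edges" by (intro edge_in_edges) simp
  then have J: "?j \<in> J" using head_J f_Suc[OF N] by metis
  have "edge ` {y \<in> {1..?N}. f (Suc y) = ?j} \<subseteq> {e \<in> edges. h e = ?j}"
    by (rule arrivals_subset[OF edge_in_edges])
  then have "card (edge ` {y \<in> {1..?N}. f (Suc y) = ?j}) \<le> c ?j"
    unfolding in_degree[OF J, symmetric] using fin_edges by (intro card_mono) auto
  then show ?thesis using arrivals[of ?N ?j] visits_total[OF J] by (auto split: if_splits)
qed

end

end


subsection \<open>Pairings and their partners\<close>

lemma pairing_unique:
  "is_pairing V M \<Longrightarrow> B \<in> M \<Longrightarrow> C \<in> M \<Longrightarrow> v \<in> B \<Longrightarrow> v \<in> C \<Longrightarrow> B = C"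
  by (auto simp: is_pairing_def partition_on_def disjoint_def)

lemma is_pairingD:
  assumes "is_pairing V M" "v \<in> V"
  shows "\<exists>!w. {v, w} \<in> M"
proof -
  from assms obtain B where B: "B \<in> M" "v \<in> B"
    by (auto simp: is_pairing_def partition_on_def)
  then have "card B = 2" using assms by (auto simp: is_pairing_def)
  then obtain w where w: "B = {v, w}" using B by (auto simp: card_2_iff)
  show ?thesis
  proof (rule ex1I)
    show "{v, w} \<in> M" using B w by simp
  next
    fix u assume u: "{v, u} \<in> M"
    then have "{v, u} = B" using pairing_unique[OF assms(1) u B(1)] B(2) by blast
    moreover have "card {v, u} = 2" using assms u by (auto simp: is_pairing_def)
    ultimately show "u = w" using w by (auto simp: doubleton_eq_iff)
  qed
qed

lemma partner_eq: "is_pairing V M \<Longrightarrow> {v, w} \<in> M \<Longrightarrow> partner M v = w"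
proof -
  assume M: "is_pairing V M" and vw: "{v, w} \<in> M"
  then have "v \<in> V" by (auto simp: is_pairing_def partition_on_def)
  then show ?thesis unfolding partner_def using is_pairingD[OF M] vw by (intro the1_equality)
qed

lemma partner_in: "is_pairing V M \<Longrightarrow> v \<in> V \<Longrightarrow> {v, partner M v} \<in> M"
  unfolding partner_def by (rule theI') (rule is_pairingD)

lemma partner_closed: "is_pairing V M \<Longrightarrow> v \<in> V \<Longrightarrow> partner M v \<in> V"
  using partner_in[of V M v] by (auto simp: is_pairing_def partition_on_def)

lemma partner_partner: "is_pairing V M \<Longrightarrow> v \<in> V \<Longrightarrow> partner M (partner M v) = v"
  using partner_in[of V M v] by (intro partner_eq) (auto simp: insert_commute)

lemma pairing_block:
  assumes "is_pairing V M" "B \<in> M" "v \<in> B"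
  shows "v \<in> V" "B = {v, partner M v}"
proof -
  show v: "v \<in> V" using assms by (auto simp: is_pairing_def partition_on_def)
  show "B = {v, partner M v}" 
    using pairing_unique[OF assms(1,2) partner_in[OF assms(1) v] assms(3)] by blast
qed

lemma pairing_subset: "is_pairing V M \<Longrightarrow> M \<subseteq> Pow V"
  by (auto simp: is_pairing_def partition_on_def)

lemma is_pairing_image:
  assumes "is_pairing V M" "bij_betw g V W"
  shows "is_pairing W ((`) g ` M)"
proof -
  have inj: "inj_on g V" and W: "g ` V = W" using assms(2) by (auto simp: bij_betw_def)
  have sub: "B \<subseteq> V" if "B \<in> M" for B using pairing_subset[OF assms(1)] that by blast
  have "partition_on W ((`) g ` M)"
  proof (rule partition_onI)
    show "\<Union> ((`) g ` M) = W"
      using assms(1) W by (auto simp: is_pairing_def partition_on_def)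
    show "{} \<notin> (`) g ` M" using assms(1) by (auto simp: is_pairing_def partition_on_def)
    fix P Q assume "P \<in> (`) g ` M" "Q \<in> (`) g ` M" "P \<noteq> Q"
    then obtain B C where BC: "B \<in> M" "C \<in> M" "P = g ` B" "Q = g ` C" "B \<noteq> C" by auto
    then have "B \<inter> C = {}"
      using assms(1) by (auto simp: is_pairing_def partition_on_def disjoint_def)
    then show "disjnt P Q"
      using BC sub inj_on_image_Int[OF inj, of B C] by (simp add: disjnt_def)
  qed
  moreover have "card (g ` B) = 2" if "B \<in> M" for B
    using that assms(1) inj_on_subset[OF inj sub[OF that]]
    by (auto simp: card_image is_pairing_def)
  ultimately show ?thesis by (auto simp: is_pairing_def)
qed

lemma partner_image:
  assumes "is_pairing V M" "bij_betw g V W" "v \<in> V"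
  shows "partner ((`) g ` M) (g v) = g (partner M v)"
proof (rule partner_eq[OF is_pairing_image[OF assms(1,2)]])
  show "{g v, g (partner M v)} \<in> (`) g ` M"
    using partner_in[OF assms(1,3)] by (auto intro: rev_image_eqI)
qed

lemma has_pair_counts_image:
  assumes "is_pairing V M" "bij_betw g V W" "\<And>v. v \<in> V \<Longrightarrow> fst (g v) = fst v"
  shows "has_pair_counts n q s ((`) g ` M) \<longleftrightarrow> has_pair_counts n q s M"
proof -
  have inj: "inj_on ((`) g) M"
    using assms(2) pairing_subset[OF assms(1)]
    by (metis bij_betw_def inj_on_image_Pow inj_on_subset)
  have fst_eq: "fst ` (g ` B) = fst ` B" if "B \<in> M" for B
    unfolding image_image using pairing_subset[OF assms(1)] that
    by (intro image_cong refl assms(3)) blast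
  have "{B \<in> (`) g ` M. fst ` B = X} = (`) g ` {B \<in> M. fst ` (g ` B) = X}" for X
    by auto
  moreover have "(`) g ` {B \<in> M. fst ` (g ` B) = X} = (`) g ` {B \<in> M. fst ` B = X}" for X
    by (intro arg_cong[where f = "(`) ((`) g)"] Collect_cong conj_cong refl) (simp only: fst_eq)
  ultimately have "card {B \<in> (`) g ` M. fst ` B = X} = card {B \<in> M. fst ` B = X}" for X
    by (simp add: card_image inj_on_subset[OF inj])
  then show ?thesis by (simp add: has_pair_counts_def)
qed


subsection \<open>Rows of an array as digraphs\<close>

lemma positions_Sigma:
  "positions n K A = (SIGMA i:{1..n}. SIGMA j:{1..K}. {1..cell_size A (i, j)})"
  by (auto simp: positions_def)

lemma finite_positions: "finite (positions n K A)"
  by (simp add: positions_Sigma)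

text \<open>
  A non-mixed pair contributes one edge to the out-degree and one to the in-degree for each of
  its ends, so balance of the mixed pairs says that in-degrees and out-degrees agree.
\<close>

lemma balanced_iff_in_degree:
  assumes M: "is_pairing (positions n K A) (pairs A)"
  shows "balanced n K A \<longleftrightarrow> (\<forall>i\<in>{1..n}. \<forall>j\<in>{1..K}.
    card {v \<in> positions n K A. row v = i \<and> col (partner (pairs A) v) = j} = cell_size A (i, j))"
proof -
  let ?P = "positions n K A" and ?m = "partner (pairs A)"
  note block = pairing_block[OF M] and pin = partner_in[OF M] and pp = partner_partner[OF M]
    and pc = partner_closed[OF M]
  have fin: "finite {v \<in> ?P. Q v}" for Q using finite_positions by simp
  have "card {v \<in> mixed_vertices A. row v = i \<and> col v = j} =
        card {B \<in> mixed_pairs A. \<exists>u v. B = {u, v} \<and> row u = i \<and> col v = j} \<longleftrightarrow>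
        card {v \<in> ?P. row v = i \<and> col (?m v) = j} = cell_size A (i, j)"
    if i: "i \<in> {1..n}" and j: "j \<in> {1..K}" for i j
  proof -
    \<comment> \<open>\<open>S\<close> collects the out-edges of column \<open>j\<close> in row
      \<open>i\<close>, \<open>T\<close> the in-edges; index 1 stands for vertices of mixed pairs,
      index 2 for pairs inside the row.\<close>
    define S1 where "S1 = {v \<in> ?P. (row v = i \<and> col v = j) \<and> row (?m v) \<noteq> i}"
    define S2 where "S2 = {v \<in> ?P. (row v = i \<and> col v = j) \<and> row (?m v) = i}"
    define T1 where "T1 = {v \<in> ?P. (row v = i \<and> col (?m v) = j) \<and> row (?m v) \<noteq> i}"
    define T2 where "T2 = {v \<in> ?P. (row v = i \<and> col (?m v) = j) \<and> row (?m v) = i}"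
    have "cell_size A (i, j) = card ((\<lambda>l. (i, j, l)) ` {1..cell_size A (i, j)})"
      by (subst card_image) (auto simp: inj_on_def)
    also have "(\<lambda>l. (i, j, l)) ` {1..cell_size A (i, j)} = S1 \<union> S2"
      using i j by (auto simp: positions_def S1_def S2_def)
    also have "card (S1 \<union> S2) = card S1 + card S2"
      unfolding S1_def S2_def by (intro card_Un_disjoint fin) auto
    finally have S: "cell_size A (i, j) = card S1 + card S2" .
    have "{v \<in> ?P. row v = i \<and> col (?m v) = j} = T1 \<union> T2"
      by (auto simp: T1_def T2_def)
    also have "card (T1 \<union> T2) = card T1 + card T2"
      unfolding T1_def T2_def by (intro card_Un_disjoint fin) auto
    finally have T: "card {v \<in> ?P. row v = i \<and> col (?m v) = j} = card T1 + card T2" .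
    \<comment> \<open>Inside a row, reversing an edge turns in-edges of \<open>j\<close> into
      out-edges, so only the mixed parts matter.\<close>
    have "bij_betw ?m T2 S2"
      by (rule bij_betw_byWitness[where f' = ?m]) (auto simp: S2_def T2_def pp pc)
    then have TS2: "card T2 = card S2" by (rule bij_betw_same_card)
    have mixed: "B \<in> mixed_pairs A \<longleftrightarrow> (\<exists>v\<in>?P. B = {v, ?m v} \<and> row (?m v) \<noteq> row v)" for B
    proof
      assume "B \<in> mixed_pairs A"
      then obtain u v where uv: "B \<in> pairs A" "u \<in> B" "v \<in> B" "row u \<noteq> row v"
        by (auto simp: mixed_pairs_def)
      then have "v = ?m u" using block(2)[OF uv(1,2)] by auto
      then show "\<exists>v\<in>?P. B = {v, ?m v} \<and> row (?m v) \<noteq> row v"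
        using block[OF uv(1,2)] uv(4) by metis
    next
      assume "\<exists>v\<in>?P. B = {v, ?m v} \<and> row (?m v) \<noteq> row v"
      then show "B \<in> mixed_pairs A" using pin unfolding mixed_pairs_def by blast
    qed
    have mv: "{v \<in> mixed_vertices A. row v = i \<and> col v = j} = S1"
    proof (intro equalityI subsetI)
      fix v assume "v \<in> {v \<in> mixed_vertices A. row v = i \<and> col v = j}"
      then obtain w where w: "w \<in> ?P" "v \<in> {w, ?m w}" "row (?m w) \<noteq> row w" "row v = i" "col v = j"
        by (auto simp: mixed_vertices_def mixed)
      then show "v \<in> S1" using pp[OF w(1)] pc[OF w(1)] unfolding S1_def by auto
    next
      fix v assume "v \<in> S1"
      then have "v \<in> ?P" "row v = i" "col v = j" "row (?m v) \<noteq> row v" by (auto simp: S1_def)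
      then show "v \<in> {v \<in> mixed_vertices A. row v = i \<and> col v = j}"
        unfolding mixed_vertices_def using mixed[of "{v, ?m v}"] by blast
    qed
    \<comment> \<open>A mixed pair meeting row \<open>i\<close> has exactly one end there, so it
      determines its vertex in \<open>T1\<close>.\<close>
    have "bij_betw (\<lambda>v. {v, ?m v}) T1
        {B \<in> mixed_pairs A. \<exists>u v. B = {u, v} \<and> row u = i \<and> col v = j}"
    proof (rule bij_betw_imageI)
      show "inj_on (\<lambda>v. {v, ?m v}) T1"
        by (rule inj_onI) (auto simp: T1_def doubleton_eq_iff)
      show "(\<lambda>v. {v, ?m v}) ` T1 =
          {B \<in> mixed_pairs A. \<exists>u v. B = {u, v} \<and> row u = i \<and> col v = j}"
      proof (intro equalityI subsetI)
        fix B assume "B \<in> (\<lambda>v. {v, ?m v}) ` T1"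
        then obtain v where v: "v \<in> ?P" "row v = i" "col (?m v) = j" "row (?m v) \<noteq> row v"
          "B = {v, ?m v}" by (auto simp: T1_def)
        then show "B \<in> {B \<in> mixed_pairs A. \<exists>u v. B = {u, v} \<and> row u = i \<and> col v = j}"
          using mixed[of B] by blast
      next
        fix B assume "B \<in> {B \<in> mixed_pairs A. \<exists>u v. B = {u, v} \<and> row u = i \<and> col v = j}"
        then obtain u v where uv: "B \<in> mixed_pairs A" "B = {u, v}" "row u = i" "col v = j" by blast
        then have B: "B \<in> pairs A" and ne: "row u \<noteq> row v" by (auto simp: mixed_pairs_def)
        have "u \<in> ?P" "v = ?m u"
          using block[OF B, of u] uv(2) ne by (auto simp: doubleton_eq_iff)
        then show "B \<in> (\<lambda>v. {v, ?m v}) ` T1"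
          using uv ne by (intro image_eqI[of _ _ u]) (auto simp: T1_def)
      qed
    qed
    then have "card T1 = card {B \<in> mixed_pairs A. \<exists>u v. B = {u, v} \<and> row u = i \<and> col v = j}"
      by (rule bij_betw_same_card)
    then show ?thesis using S T TS2 mv by auto
  qed
  then show ?thesis unfolding balanced_def by blast
qed

text \<open>The iteration adds new applications at the end; inductions along a path need the first
  application split off instead.\<close>

lemma map_comp_funpow_Suc:
  "((\<circ>\<^sub>m) f ^^ Suc t) Some j = (case f j of None \<Rightarrow> None | Some v \<Rightarrow> ((\<circ>\<^sub>m) f ^^ t) Some v)"
proof (induction t)
  case (Suc t)
  have "((\<circ>\<^sub>m) f ^^ Suc (Suc t)) Some j = (f \<circ>\<^sub>m ((\<circ>\<^sub>m) f ^^ Suc t) Some) j" by simp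
  also have "\<dots> = (case f j of None \<Rightarrow> None | Some v \<Rightarrow> (f \<circ>\<^sub>m ((\<circ>\<^sub>m) f ^^ t) Some) v)"
    unfolding map_comp_def Suc by (simp split: option.split)
  finally show ?case by (simp only: funpow.simps o_def)
qed (simp add: map_comp_def split: option.split)


subsection \<open>From paired functions to arrays\<close>

definition place :: "(nat \<times> nat \<Rightarrow> nat) \<Rightarrow> nat \<times> nat \<Rightarrow> position" where
  "place f v = (fst v, f v, visits (\<lambda>x. f (fst v, x)) (snd v) (f v))"

definition array_of ::
    "nat \<Rightarrow> nat \<Rightarrow> (nat \<Rightarrow> nat) \<Rightarrow> (nat \<times> nat) set set \<times> (nat \<times> nat \<Rightarrow> nat) \<Rightarrow> array" where
  "array_of n K p = (\<lambda>(M, f).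
     \<lparr>cell_size = (\<lambda>(i, j) \<in> {1..n} \<times> {1..K}. visits (\<lambda>x. f (i, x)) (p i) j),
      marked = (\<lambda>i. (i, f (i, 1))) ` {1..n},
      pairs = (`) (place f) ` M\<rparr>)"

lemma fst_place [simp]: "fst (place f v) = fst v"
  and col_place [simp]: "col (place f v) = f v"
  by (simp_all add: place_def)

text \<open>Only the cell sizes of \<open>A\<close> matter here, so the lemma serves both for the
  array built from \<open>f\<close> and for a given canonical array whose tours define
  \<open>f\<close>.\<close>

lemma place_bij_betw:
  assumes f: "f \<in> labels n p \<rightarrow> {1..K}"
    and cs: "\<And>i j. i \<in> {1..n} \<Longrightarrow> j \<in> {1..K} \<Longrightarrow> cell_size A (i, j) = visits (\<lambda>x. f (i, x)) (p i) j"
  shows "bij_betw (place f) (labels n p) (positions n K A)"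
proof (rule bij_betw_imageI)
  show "inj_on (place f) (labels n p)"
  proof (rule inj_onI)
    fix v w assume "place f v = place f w"
    moreover obtain i x where v: "v = (i, x)" by (cases v)
    moreover obtain k y where w: "w = (k, y)" by (cases w)
    ultimately have ik: "i = k" and eq: "(f (i, x), visits (\<lambda>x. f (i, x)) x (f (i, x)))
        = (f (i, y), visits (\<lambda>x. f (i, x)) y (f (i, y)))"
      by (auto simp: place_def)
    have "x = y" by (rule inj_onD[OF inj_on_visits[of "\<lambda>x. f (i, x)" UNIV] eq]) simp_all
    then show "v = w" using v w ik by simp
  qed
  have row: "(\<lambda>x. (f (i, x), visits (\<lambda>x. f (i, x)) x (f (i, x)))) ` {1..p i}
      = (SIGMA j:{1..K}. {1..cell_size A (i, j)})" if "i \<in> {1..n}" for i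
  proof -
    have "(\<lambda>x. (f (i, x), visits (\<lambda>x. f (i, x)) x (f (i, x)))) ` {1..p i}
        = (SIGMA j:{1..K}. {1..visits (\<lambda>x. f (i, x)) (p i) j})"
      using that f by (intro bij_betw_imp_surj_on[OF bij_betw_visits]) (auto simp: labels_def Pi_iff)
    also have "\<dots> = (SIGMA j:{1..K}. {1..cell_size A (i, j)})"
      using cs[OF that] by (intro Sigma_cong) auto
    finally show ?thesis .
  qed
  have "place f ` labels n p =
      (\<Union>i\<in>{1..n}. Pair i ` (\<lambda>x. (f (i, x), visits (\<lambda>x. f (i, x)) x (f (i, x)))) ` {1..p i})"
    by (force simp: labels_def place_def image_iff)
  also have "\<dots> = (\<Union>i\<in>{1..n}. Pair i ` (SIGMA j:{1..K}. {1..cell_size A (i, j)}))"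
    using row by (intro SUP_cong arg_cong[where f = "\<lambda>X. Pair _ ` X"]) auto
  also have "\<dots> = positions n K A" by (force simp: positions_def)
  finally show "place f ` labels n p = positions n K A" .
qed

lemma finite_labels: "finite (labels n p)"
  by (simp add: labels_def)

lemma cyc_bij_betw: "bij_betw (cyc p) (labels n p) (labels n p)"
proof -
  have "inj_on (cyc p) (labels n p)"
    by (auto simp: inj_on_def cyc_def labels_def split: if_splits)
  moreover have "cyc p ` labels n p \<subseteq> labels n p"
    by (auto simp: cyc_def labels_def)
  ultimately show ?thesis
    using endo_inj_surj[OF finite_labels] by (auto simp: bij_betw_def)
qed

lemma card_label_fiber:
  assumes "i \<in> {1..n}"
  shows "card {v \<in> labels n p. fst v = i \<and> f v = j} = visits (\<lambda>x. f (i, x)) (p i) j"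
proof -
  have "{v \<in> labels n p. fst v = i \<and> f v = j} = Pair i ` {y \<in> {1..p i}. f (i, y) = j}"
    using assms by (auto simp: labels_def)
  then show ?thesis by (simp add: visits_def card_image inj_on_def)
qed

text \<open>\<open>cyc p\<close> permutes the labels and keeps rows, so the fibers are merely
  reindexed. For a paired function this is the equality of in-degree and out-degree.\<close>

lemma card_cyc_fiber:
  "card {v \<in> labels n p. fst v = i \<and> f (cyc p v) = j} = card {v \<in> labels n p. fst v = i \<and> f v = j}"
proof -
  have inj: "inj_on (cyc p) (labels n p)" and onto: "cyc p ` labels n p = labels n p"
    using cyc_bij_betw by (auto simp: bij_betw_def)
  have fst_cyc: "fst (cyc p v) = fst v" for v by (auto simp: cyc_def split: prod.splits)
  have "cyc p ` {v \<in> labels n p. fst (cyc p v) = i \<and> f (cyc p v) = j}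
      = {v \<in> cyc p ` labels n p. fst v = i \<and> f v = j}" by blast
  then have "cyc p ` {v \<in> labels n p. fst v = i \<and> f (cyc p v) = j}
      = {v \<in> labels n p. fst v = i \<and> f v = j}" by (simp only: onto fst_cyc)
  then show ?thesis
    using card_image[OF inj_on_subset[OF inj], of "{v \<in> labels n p. fst v = i \<and> f (cyc p v) = j}"]
    by auto
qed

text \<open>
  Each step goes from a column to the one visited right after the last visit, so the time of
  the last visit strictly increases until the tour ends, back at its start.
\<close>

lemma last_exits_reach_start:
  assumes step: "\<And>x. x \<in> {1..N} \<Longrightarrow> visits g x (g x) = visits g N (g x) \<Longrightarrow> g x \<noteq> g 1 \<Longrightarrow>
      \<psi> (g x) = Some (if x = N then g 1 else g (Suc x))"
  assumes "x \<in> {1..N}" "visits g x (g x) = visits g N (g x)" "g x \<noteq> g 1"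
  shows "\<exists>t\<ge>1. ((\<circ>\<^sub>m) \<psi> ^^ t) Some (g x) = Some (g 1)"
  using assms(2-4)
proof (induction "N - x" arbitrary: x rule: less_induct)
  case less
  note psi = step[OF less.prems]
  show ?case
  proof (cases "x = N \<or> g (Suc x) = g 1")
    case True
    then have "((\<circ>\<^sub>m) \<psi> ^^ 1) Some (g x) = Some (g 1)" using psi by (auto simp: map_comp_def)
    then show ?thesis by blast
  next
    case False
    let ?k = "g (Suc x)"
    have xN: "Suc x \<le> N" using False less.prems by auto
    have "1 \<le> visits g (Suc x) ?k" by (rule visits_pos) simp
    then have "visits g N ?k \<in> {1..visits g N ?k}" using visits_mono[OF xN, of g ?k] by simp
    then obtain y where y: "y \<in> {1..N}" "g y = ?k" "visits g y ?k = visits g N ?k"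
      using ex_visit by metis
    \<comment> \<open>The time \<open>y\<close> of the last visit to \<open>?k\<close> cannot
      precede \<open>Suc x\<close>, which is itself a visit to \<open>?k\<close>.\<close>
    have "\<not> y < Suc x" using visits_less[of y "Suc x" g] visits_mono[OF xN, of g ?k] y(3) by auto
    then have "N - y < N - x" using xN by simp
    then obtain t where "t \<ge> 1" "((\<circ>\<^sub>m) \<psi> ^^ t) Some ?k = Some (g 1)"
      using less.hyps[of y] y False by auto
    moreover have "\<psi> (g x) = Some ?k" using psi False by simp
    ultimately have "((\<circ>\<^sub>m) \<psi> ^^ Suc t) Some (g x) = Some (g 1)"
      unfolding map_comp_funpow_Suc by simp
    then show ?thesis by (metis Suc_eq_plus1 le_add2)
  qed
qed

section \<open>The array of a paired function is canonical\<close>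

context
  fixes n K :: nat and q :: "nat \<Rightarrow> nat" and s :: "nat \<Rightarrow> nat \<Rightarrow> nat"
  assumes row_pos: "\<And>i. i \<in> {1..n} \<Longrightarrow> row_size n q s i \<ge> 1"
begin

private abbreviation (input) "p \<equiv> row_size n q s"
private abbreviation (input) "L \<equiv> labels n p"

lemma paired_functionsD:
  assumes "(M, f) \<in> paired_functions n K q s"
  shows "is_pairing L M" "has_pair_counts n q s M" "f \<in> L \<rightarrow>\<^sub>E {1..K}" "f \<in> L \<rightarrow> {1..K}"
    "\<And>v. v \<in> L \<Longrightarrow> f (partner M v) = f (cyc p v)"
  using assms by (auto simp: paired_functions_def pairings_def PiE_def)

lemma label_1: "i \<in> {1..n} \<Longrightarrow> (i, 1) \<in> L"
  using row_pos by (auto simp: labels_def)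

lemma array_of_place_bij_betw:
  assumes "(M, f) \<in> paired_functions n K q s"
  shows "bij_betw (place f) L (positions n K (array_of n K p (M, f)))"
  by (rule place_bij_betw[OF paired_functionsD(4)[OF assms]]) (simp add: array_of_def)

lemma partner_place:
  assumes "(M, f) \<in> paired_functions n K q s" "v \<in> L"
  shows "partner (pairs (array_of n K p (M, f))) (place f v) = place f (partner M v)"
  using partner_image[OF paired_functionsD(1)[OF assms(1)] array_of_place_bij_betw[OF assms(1)] assms(2)]
  by (simp add: array_of_def)

lemma array_of_canonical:
  assumes Mf: "(M, f) \<in> paired_functions n K q s"
  shows "array_of n K p (M, f) \<in> canonical_arrays n K q s"
proof -
  let ?A = "array_of n K p (M, f)"
  note D = paired_functionsD[OF Mf] and bij = array_of_place_bij_betw[OF Mf]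
  have f_in: "f (i, x) \<in> {1..K}" if "i \<in> {1..n}" "x \<in> {1..p i}" for i x
    using D(4) that by (auto simp: labels_def)
  have cs: "cell_size ?A (i, j) = visits (\<lambda>x. f (i, x)) (p i) j"
    if "i \<in> {1..n}" "j \<in> {1..K}" for i j using that by (simp add: array_of_def)
  have pairing: "is_pairing (positions n K ?A) (pairs ?A)"
    using is_pairing_image[OF D(1) bij] by (simp add: array_of_def)
  have marked: "marked_cols ?A i = {f (i, 1)}" if "i \<in> {1..n}" for i
    using that by (auto simp: marked_cols_def array_of_def)
  have "is_paired_array n K q s (\<lambda>i. 1) ?A"
    unfolding is_paired_array_def
  proof (intro conjI ballI)
    show "cell_size ?A \<in> extensional ({1..n} \<times> {1..K})" by (simp add: array_of_def)
    show "(\<Sum>j\<in>{1..K}. cell_size ?A (i, j)) = p i" if i: "i \<in> {1..n}" for i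
    proof -
      have "(\<Sum>j\<in>{1..K}. cell_size ?A (i, j)) = (\<Sum>j\<in>{1..K}. visits (\<lambda>x. f (i, x)) (p i) j)"
        using cs[OF i] by (intro sum.cong) auto
      also have "\<dots> = p i" using f_in[OF i] by (intro sum_visits) auto
      finally show ?thesis .
    qed
    show "is_pairing (positions n K ?A) (pairs ?A)" by (rule pairing)
    show "has_pair_counts n q s (pairs ?A)"
      using has_pair_counts_image[OF D(1) bij] D(2) by (simp add: array_of_def)
    show "marked ?A \<subseteq> {1..n} \<times> {1..K}"
      using label_1 D(4) by (auto simp: array_of_def)
    show "card {j. (i, j) \<in> marked ?A} = 1" if "i \<in> {1..n}" for i
      using marked[OF that] by (simp add: marked_cols_def)
  qed
  moreover have "balanced n K ?A"
    unfolding balanced_iff_in_degree[OF pairing]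
  proof (intro ballI)
    fix i j assume i: "i \<in> {1..n}" and j: "j \<in> {1..K}"
    have "{v \<in> positions n K ?A. row v = i \<and> col (partner (pairs ?A) v) = j}
        = {v \<in> place f ` L. row v = i \<and> col (partner (pairs ?A) v) = j}"
      using bij by (simp add: bij_betw_def)
    \<comment> \<open>The partner of \<open>place f v\<close> lies in column
      \<open>f (partner M v)\<close>, which is \<open>f (cyc p v)\<close>, the next column of the
      cyclic tour.\<close>
    also have "\<dots> = place f ` {v \<in> L. fst v = i \<and> f (cyc p v) = j}"
      using partner_place[OF Mf] D(5) by (auto simp: image_iff)
    finally have "card {v \<in> positions n K ?A. row v = i \<and> col (partner (pairs ?A) v) = j}
        = card (place f ` {v \<in> L. fst v = i \<and> f (cyc p v) = j})" by (rule arg_cong)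
    also have "\<dots> = card {v \<in> L. fst v = i \<and> f (cyc p v) = j}"
      by (rule card_image, rule inj_on_subset[OF bij_betw_imp_inj_on[OF bij]], rule Collect_restrict)
    also have "\<dots> = card {v \<in> L. fst v = i \<and> f v = j}" by (rule card_cyc_fiber)
    also have "\<dots> = visits (\<lambda>x. f (i, x)) (p i) j" by (rule card_label_fiber[OF i])
    also have "\<dots> = cell_size ?A (i, j)" by (rule cs[OF i j, symmetric])
    finally show "card {v \<in> positions n K ?A. row v = i \<and> col (partner (pairs ?A) v) = j}
        = cell_size ?A (i, j)" .
  qed
  moreover have "forest_cond n K ?A"
    unfolding forest_cond_def
  proof (intro ballI)
    fix i j assume i: "i \<in> {1..n}" and j: "j \<in> nonempty_cols K ?A i - marked_cols ?A i"
    define g where "g = (\<lambda>x. f (i, x))"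
    have jK: "j \<in> {1..K}" and pos: "cell_size ?A (i, j) > 0" and j1: "j \<noteq> g 1"
      using j marked[OF i] by (auto simp: nonempty_cols_def g_def)
    have csg: "cell_size ?A (i, k) = visits g (p i) k" if "k \<in> {1..K}" for k
      using cs[OF i that] by (simp add: g_def)
    \<comment> \<open>At the last visit to its column, the vertex \<open>x\<close> is the rightmost
      one of its cell, so \<open>psi\<close> reads off the next column of the tour; after
      \<open>p i\<close> the tour returns to \<open>g 1\<close>.\<close>
    have step: "psi K ?A i (g x) = Some (if x = p i then g 1 else g (Suc x))"
      if x: "x \<in> {1..p i}" and last: "visits g x (g x) = visits g (p i) (g x)" and ne: "g x \<noteq> g 1" for x
    proof -
      have gK: "g x \<in> {1..K}" using f_in[OF i x] by (simp add: g_def)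
      have v: "(i, x) \<in> L" using i x by (auto simp: labels_def)
      have "visits g (p i) (g x) > 0" using visits_pos[of x g] x last by simp
      then have "g x \<in> nonempty_cols K ?A i - marked_cols ?A i"
        using gK csg[OF gK] ne marked[OF i] by (simp add: nonempty_cols_def g_def)
      moreover have "(i, g x, cell_size ?A (i, g x)) = place f (i, x)"
        unfolding csg[OF gK] last[symmetric] by (simp add: place_def g_def)
      ultimately have "psi K ?A i (g x) = Some (f (cyc p (i, x)))"
        using partner_place[OF Mf v] D(5)[OF v] by (simp add: psi_def)
      then show ?thesis by (simp add: cyc_def g_def)
    qed
    have "visits g (p i) j \<in> {1..visits g (p i) j}" using pos csg[OF jK] by simp
    then obtain x where x: "x \<in> {1..p i}" "g x = j" "visits g x j = visits g (p i) j"
      using ex_visit by metis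
    have "\<exists>t\<ge>1. ((\<circ>\<^sub>m) (psi K ?A i) ^^ t) Some (g x) = Some (g 1)"
      using x j1 by (intro last_exits_reach_start[OF step]) auto
    then show "\<exists>t\<ge>1. \<exists>r\<in>marked_cols ?A i. ((\<circ>\<^sub>m) (psi K ?A i) ^^ t) Some j = Some r"
      using x(2) marked[OF i] by (auto simp: g_def)
  qed
  ultimately show ?thesis by (simp add: canonical_arrays_def proper_def)
qed

section \<open>A paired function is determined by its array\<close>

text \<open>The tour can be read off step by step: the mark gives the first column, and the values
  up to \<open>z\<close> fix the position of vertex \<open>z\<close>, whose partner lies in the next
  column. Once \<open>f\<close> is known, the injective \<open>place f\<close> gives back the
  pairing.\<close>

lemma array_of_inj: "inj_on (array_of n K p) (paired_functions n K q s)"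
proof (rule inj_onI, clarify)
  fix M f M' f'
  assume Mf: "(M, f) \<in> paired_functions n K q s" and Mf': "(M', f') \<in> paired_functions n K q s"
    and eq: "array_of n K p (M, f) = array_of n K p (M', f')"
  note D = paired_functionsD[OF Mf] and D' = paired_functionsD[OF Mf']
  have same: "f (i, x) = f' (i, x)" if i: "i \<in> {1..n}" and "x \<in> {1..p i}" for i x
    using that(2)
  proof (induction x rule: less_induct)
    case (less x)
    show ?case
    proof (cases "x = 1")
      case True
      have "(i, f (i, 1)) \<in> marked (array_of n K p (M', f'))"
        unfolding eq[symmetric] using i by (simp add: array_of_def)
      then show ?thesis using True by (auto simp: array_of_def)
    next
      case False
      then obtain z where z: "x = Suc z" "z \<ge> 1" using less.prems by (cases x) auto
      then have v: "(i, z) \<in> L" and cyc: "cyc p (i, z) = (i, x)"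
        using i less.prems by (auto simp: labels_def cyc_def)
      have IH: "f (i, y) = f' (i, y)" if "y \<in> {1..z}" for y using less that z by auto
      then have "visits (\<lambda>x. f (i, x)) z = visits (\<lambda>x. f' (i, x)) z"
        by (intro ext visits_cong)
      then have "place f (i, z) = place f' (i, z)" using IH[of z] z by (simp add: place_def)
      then have "place f (partner M (i, z)) = place f' (partner M' (i, z))"
        using partner_place[OF Mf v] partner_place[OF Mf' v] eq by simp
      then have "f (partner M (i, z)) = f' (partner M' (i, z))" by (metis col_place)
      then show ?thesis using D(5)[OF v] D'(5)[OF v] cyc by simp
    qed
  qed
  have ff': "f = f'"
    using D(3) D'(3) by (rule PiE_ext) (auto simp: labels_def intro: same)
  have "(`) (place f) ` M = (`) (place f) ` M'" using eq by (simp add: array_of_def ff')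
  then have "M = M'"
    using inj_on_image_eq_iff[OF inj_on_image_Pow[OF bij_betw_imp_inj_on[OF array_of_place_bij_betw[OF Mf]]]
        pairing_subset[OF D(1)] pairing_subset[OF D'(1)]] by simp
  then show "M = M' \<and> f = f'" using ff' by blast
qed

section \<open>Every canonical array comes from a paired function\<close>

text \<open>A position \<open>(i, j, l)\<close> is literally row \<open>i\<close> paired with the
  edge \<open>(j, l)\<close>. Only the column of the partner matters for the head, so partners in
  other rows cause no trouble.\<close>

lemma canonical_row_eulerian:
  assumes A: "A \<in> canonical_arrays n K q s" and i: "i \<in> {1..n}" and r: "marked_cols A i = {r}"
  shows "eulerian {1..K} (\<lambda>j. cell_size A (i, j)) (\<lambda>e. col (partner (pairs A) (i, e))) r"
proof
  let ?J = "{1..K}" and ?c = "\<lambda>j. cell_size A (i, j)"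
    and ?h = "\<lambda>e. col (partner (pairs A) (i, e))"
  have arr: "is_paired_array n K q s (\<lambda>i. 1) A" and bal: "balanced n K A"
    and forest: "forest_cond n K A"
    using A by (auto simp: canonical_arrays_def proper_def)
  have pairing: "is_pairing (positions n K A) (pairs A)"
    using arr by (simp add: is_paired_array_def)
  have edge: "(i, e) \<in> positions n K A \<longleftrightarrow> e \<in> (SIGMA j:?J. {1..?c j})" for e
    using i by (auto simp: positions_Sigma)
  show "finite ?J" by simp
  show "?h e \<in> ?J" if "e \<in> (SIGMA j:?J. {1..?c j})" for e
    using partner_closed[OF pairing, of "(i, e)"] that unfolding edge by (auto simp: positions_def)
  show "card {e \<in> (SIGMA j:?J. {1..?c j}). ?h e = j} = ?c j" if "j \<in> ?J" for j
  proof -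
    have "Pair i ` {e \<in> (SIGMA j:?J. {1..?c j}). ?h e = j}
        = {v \<in> positions n K A. row v = i \<and> col (partner (pairs A) v) = j}"
      unfolding edge[symmetric] by force
    then have "card {e \<in> (SIGMA j:?J. {1..?c j}). ?h e = j}
        = card {v \<in> positions n K A. row v = i \<and> col (partner (pairs A) v) = j}"
      by (metis (no_types, lifting) card_image inj_on_def prod.inject)
    then show ?thesis using bal i that unfolding balanced_iff_in_degree[OF pairing] by simp
  qed
  show "r \<in> ?J" using arr r by (auto simp: is_paired_array_def marked_cols_def)
  have "(\<Sum>j\<in>?J. ?c j) \<noteq> 0" using arr i row_pos[OF i] by (simp add: is_paired_array_def)
  then show "\<exists>j\<in>?J. ?c j > 0" by (metis gr0I sum.neutral)
  show "j \<in> S" if rS: "r \<in> S" and closed: "\<And>j. j \<in> ?J \<Longrightarrow> ?c j > 0 \<Longrightarrow> ?h (j, ?c j) \<in> S \<Longrightarrow> j \<in> S"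
    and j: "j \<in> ?J" "?c j > 0" for S j
  proof (cases "j = r")
    case False
    \<comment> \<open>Membership in \<open>S\<close> is carried back from \<open>r\<close> along a
      path of \<open>psi\<close>; since \<open>psi\<close> is defined at \<open>k\<close>, its cell
      is nonempty and \<open>closed\<close> applies.\<close>
    have reach: "((\<circ>\<^sub>m) (psi K A i) ^^ t) Some k = Some r \<Longrightarrow> k \<in> S" for t k
    proof (induction t arbitrary: k)
      case 0
      then show ?case using rS by simp
    next
      case (Suc t)
      then obtain m where m: "psi K A i k = Some m" "((\<circ>\<^sub>m) (psi K A i) ^^ t) Some m = Some r"
        unfolding map_comp_funpow_Suc by (auto split: option.splits)
      then have "m \<in> S" using Suc.IH by blast
      moreover have "k \<in> ?J" "?c k > 0" "?h (k, ?c k) = m"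
        using m(1) by (simp_all add: psi_def nonempty_cols_def split: if_splits)
      ultimately show ?case using closed[of k] by simp
    qed
    have "j \<in> nonempty_cols K A i - marked_cols A i"
      using j False r by (auto simp: nonempty_cols_def)
    then have "\<exists>t\<ge>1. \<exists>r\<in>marked_cols A i. ((\<circ>\<^sub>m) (psi K A i) ^^ t) Some j = Some r"
      using forest i unfolding forest_cond_def by simp
    then show ?thesis using r by (auto intro: reach)
  qed (use rS in simp)
qed

text \<open>The greedy walks of the rows, cut off after \<open>p i\<close> steps, form
  \<open>f\<close>. They use each position exactly once, so \<open>place f\<close> is a bijection
  along which the pairing is pulled back to labels.\<close>

lemma array_of_surj:
  assumes A: "A \<in> canonical_arrays n K q s"
  shows "A \<in> array_of n K p ` paired_functions n K q s"
proof -
  let ?h = "\<lambda>i e. col (partner (pairs A) (i, e))"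
  have arr: "is_paired_array n K q s (\<lambda>i. 1) A" using A by (simp add: canonical_arrays_def)
  have pairing: "is_pairing (positions n K A) (pairs A)"
    and size: "\<And>i. i \<in> {1..n} \<Longrightarrow> (\<Sum>j\<in>{1..K}. cell_size A (i, j)) = p i"
    using arr by (auto simp: is_paired_array_def)
  have "\<exists>r. marked_cols A i = {r}" if "i \<in> {1..n}" for i
    using arr that by (auto simp: is_paired_array_def marked_cols_def card_1_singleton_iff)
  then obtain r where r: "\<And>i. i \<in> {1..n} \<Longrightarrow> marked_cols A i = {r i}" by metis
  have "\<forall>i. \<exists>g. greedy_walk (?h i) (r i) g" by (intro allI greedy_walk_exists)
  then have "\<exists>g. \<forall>i. greedy_walk (?h i) (r i) (g i)" by (rule choice)
  then obtain g where g: "\<And>i. greedy_walk (?h i) (r i) (g i)" by blast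
  have tour: "g i 1 = r i" "\<And>x. x \<in> {1..p i} \<Longrightarrow> g i (Suc x) = ?h i (g i x, visits (g i) x (g i x))"
    "\<And>x. x \<in> {1..p i} \<Longrightarrow> g i x \<in> {1..K}"
    "\<And>j. j \<in> {1..K} \<Longrightarrow> visits (g i) (p i) j = cell_size A (i, j)"
    "g i (Suc (p i)) = r i" if i: "i \<in> {1..n}" for i
  proof -
    interpret eulerian "{1..K}" "\<lambda>j. cell_size A (i, j)" "?h i" "r i"
      by (rule canonical_row_eulerian[OF A i r[OF i]])
    show "g i 1 = r i" by (rule f_1[OF g])
    show "\<And>x. x \<in> {1..p i} \<Longrightarrow> g i (Suc x) = ?h i (g i x, visits (g i) x (g i x))"
      by (rule f_Suc[OF g]) simp
    show "\<And>x. x \<in> {1..p i} \<Longrightarrow> g i x \<in> {1..K}"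
      using f_in_J[OF g] unfolding size[OF i] .
    show "\<And>j. j \<in> {1..K} \<Longrightarrow> visits (g i) (p i) j = cell_size A (i, j)"
      using visits_total[OF g] unfolding size[OF i] .
    show "g i (Suc (p i)) = r i" using walk_closes[OF g] unfolding size[OF i] .
  qed
  define f where "f = (\<lambda>(i, x) \<in> L. g i x)"
  have f_eq: "f (i, x) = g i x" if "i \<in> {1..n}" "x \<in> {1..p i}" for i x
    using that by (simp add: f_def labels_def)
  have vis: "visits (\<lambda>x. f (i, x)) x = visits (g i) x" if "i \<in> {1..n}" "x \<le> p i" for i x
    using that f_eq by (intro ext visits_cong) auto
  have f_PiE: "f \<in> L \<rightarrow>\<^sub>E {1..K}"
    using tour(3) by (auto simp: f_def labels_def)
  have cs: "cell_size A (i, j) = visits (\<lambda>x. f (i, x)) (p i) j"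
    if "i \<in> {1..n}" "j \<in> {1..K}" for i j using vis[OF that(1)] tour(4)[OF that] by simp
  have bij: "bij_betw (place f) L (positions n K A)"
    using f_PiE by (intro place_bij_betw cs) (auto simp: PiE_def)
  define M where "M = (`) (inv_into L (place f)) ` pairs A"
  have M: "is_pairing L M"
    unfolding M_def by (rule is_pairing_image[OF pairing bij_betw_inv_into[OF bij]])
  have pairs: "(`) (place f) ` M = pairs A"
  proof -
    have "place f ` inv_into L (place f) ` B = B" if "B \<in> pairs A" for B
      using pairing_subset[OF pairing] that bij by (intro image_inv_into_cancel) (auto simp: bij_betw_def)
    then show ?thesis by (simp add: M_def image_image)
  qed
  have "has_pair_counts n q s M"
    using has_pair_counts_image[OF M bij] arr by (simp add: pairs is_paired_array_def)
  moreover have "f (partner M v) = f (cyc p v)" if v: "v \<in> L" for v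
  proof -
    obtain i x where ix: "v = (i, x)" "i \<in> {1..n}" "x \<in> {1..p i}" using v by (auto simp: labels_def)
    have "f (partner M v) = col (partner (pairs A) (place f v))"
      using partner_image[OF M bij v] by (simp add: pairs)
    also have "\<dots> = g i (Suc x)"
      using ix vis[of i x] f_eq[of i x] tour(2)[of i x] by (simp add: place_def)
    \<comment> \<open>For \<open>x = p i\<close> the label \<open>cyc p v\<close> is
      \<open>(i, 1)\<close>; the equality then says that the tour closes up at
      \<open>r i\<close>.\<close>
    also have "\<dots> = f (cyc p v)"
      using ix f_eq[of i 1] f_eq[of i "Suc x"] tour(1,5)[of i] row_pos[of i] by (auto simp: cyc_def)
    finally show ?thesis .
  qed
  ultimately have Mf: "(M, f) \<in> paired_functions n K q s"
    using M f_PiE by (auto simp: paired_functions_def pairings_def)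
  have "cell_size (array_of n K p (M, f)) = cell_size A"
  proof (rule extensionalityI[of _ "{1..n} \<times> {1..K}"])
    show "cell_size (array_of n K p (M, f)) \<in> extensional ({1..n} \<times> {1..K})"
      by (simp add: array_of_def)
    show "cell_size A \<in> extensional ({1..n} \<times> {1..K})"
      using arr by (simp add: is_paired_array_def)
  qed (auto simp: array_of_def cs)
  moreover have "marked (array_of n K p (M, f)) = marked A"
  proof -
    have "marked A = (\<lambda>i. (i, r i)) ` {1..n}"
    proof -
      have mem: "(i, j) \<in> marked A \<longleftrightarrow> j = r i" if "i \<in> {1..n}" for i j
        using r[OF that] by (auto simp: marked_cols_def)
      have "marked A \<subseteq> {1..n} \<times> {1..K}" using arr by (simp add: is_paired_array_def)
      then have "marked A = {v. fst v \<in> {1..n} \<and> v \<in> marked A}" by auto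
      also have "\<dots> = (\<lambda>i. (i, r i)) ` {1..n}" using mem by auto
      finally show ?thesis .
    qed
    also have "\<dots> = marked (array_of n K p (M, f))"
      using f_eq row_pos tour(1) by (simp add: array_of_def)
    finally show ?thesis ..
  qed
  moreover have "pairs (array_of n K p (M, f)) = pairs A"
    by (simp add: array_of_def pairs)
  ultimately have "A = array_of n K p (M, f)" by simp
  then show ?thesis using Mf by blast
qed

end

theorem theorem2p6:
  fixes n K :: nat and q :: "nat \<Rightarrow> nat" and s :: "nat \<Rightarrow> nat \<Rightarrow> nat"
  assumes "n \<ge> 1" and "K \<ge> 1"
    and "\<And>i k. i \<in> {1..n} \<Longrightarrow> k \<in> {1..n} \<Longrightarrow> s k i = s i k"
    and "\<And>i. i \<in> {1..n} \<Longrightarrow> row_size n q s i \<ge> 1"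
  shows "num_paired_functions n K q s = num_canonical_arrays n K q s"
proof -
  have "bij_betw (array_of n K (row_size n q s)) (paired_functions n K q s) (canonical_arrays n K q s)"
    using array_of_inj[OF assms(4)] array_of_canonical[OF assms(4)] array_of_surj[OF assms(4)]
    by (intro bij_betw_imageI) auto
  then show ?thesis
    unfolding num_paired_functions_def num_canonical_arrays_def by (rule bij_betw_same_card)
qed

end
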